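(* Let $$X=\{(x,y,t)\in\{0,1\}^2\times\mathbb{R}^2\times\mathbb{R} : (y_1-y_2)^2\le t,\ 0\le y_i\le x_i,\ i=1,2\}.$$ The inequality $$\frac{y_1^2}{x_1}+\frac{y_2^2}{x_2}-2y_2\le t$$ is valid for $X$ (i.e., satisfied by every point of $X$), and it is the strongest convex inequality of the form $$\frac{y_1^2}{x_1}+h(x_2,y_2)\le t,\qquad h:[0,1]\times\mathbb{R}_+\to\mathbb{R}\ \text{convex};$$ that is, whenever $h$ is convex and $\frac{y_1^2}{x_1}+h(x_2,y_2)\le t$ is valid for $X$, then $h(x_2,y_2)\le \frac{y_2^2}{x_2}-2y_2$ for all $(x_2,y_2)$ with $0\le y_2\le x_2\le 1$.
   Context: Convention for division by zero: $0/0=0$ and $a/0=\infty$ for $a>0$. "Strongest" means that every other valid convex inequality of the given form is dominated by the stated inequality on the region $0\le y_i\le x_i\le 1$, $i=1,2$. *)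

theory Defs
  imports "HOL-Analysis.Analysis"
begin

definition X :: "((real^2) \<times> (real^2) \<times> real) set" where
  "X = {(x, y, t). (\<forall>i. x $ i \<in> {0, 1}) \<and> (y $ 1 - y $ 2)\<^sup>2 \<le> t \<and>
                   (\<forall>i. 0 \<le> y $ i \<and> y $ i \<le> x $ i)}"

(* Division on ereal already satisfies 0 / 0 = 0 and a / 0 = \<infinity> for a > 0,
   so the quotients y^2 / x below are formed there. *)

lemma ereal_zero_div_zero: "ereal 0 / ereal 0 = 0"
  by simp

lemma ereal_pos_div_zero: "a > 0 \<Longrightarrow> ereal a / ereal 0 = \<infinity>"
  by (simp add: divide_ereal_def)

definition valid_for_X :: "(real^2 \<Rightarrow> real^2 \<Rightarrow> ereal) \<Rightarrow> bool" where
  "valid_for_X F \<longleftrightarrow> (\<forall>(x, y, t) \<in> X. F x y \<le> ereal t)"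

definition form_lhs :: "(real \<times> real \<Rightarrow> ereal) \<Rightarrow> real^2 \<Rightarrow> real^2 \<Rightarrow> ereal" where
  "form_lhs h x y = ereal ((y $ 1)\<^sup>2) / ereal (x $ 1) + h (x $ 2, y $ 2)"

definition h_opt :: "real \<times> real \<Rightarrow> ereal" where
  "h_opt = (\<lambda>(x2, y2). ereal (y2\<^sup>2) / ereal x2 - ereal (2 * y2))"

(* Convexity of an extended-real-valued function, via its epigraph; needed because
   h_opt is infinite at (0, y2) for y2 > 0. *)
definition ext_convex_on :: "'a::real_vector set \<Rightarrow> ('a \<Rightarrow> ereal) \<Rightarrow> bool" where
  "ext_convex_on S f \<longleftrightarrow> convex {(p, s). p \<in> S \<and> f p \<le> ereal s}"

lemma ext_convex_on_ereal:
  assumes "convex S"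
  shows "ext_convex_on S (\<lambda>p. ereal (f p)) \<longleftrightarrow> convex_on S f"
proof -
  have "{(p, s). p \<in> S \<and> ereal (f p) \<le> ereal s} = epigraph S f"
    by (auto simp: epigraph_def)
  then show ?thesis
    using assms by (simp add: ext_convex_on_def convex_epigraph)
qed

end

(* h_opt is the perspective y^2/x of the square plus a linear term, so its epigraph is the
   preimage of a rotated second-order cone under an affine map.  It is optimal because validity
   at the points with x_1 = y_1 = 1 bounds h at (0,0) and at all (1,z), and (x,y) lies on the
   segment from (0,0) to (1,y/x). *)
theory Submission imports Defs begin

text \<open>Multiplying the two cone constraints bounds \<open>(y * y')\<^sup>2\<close> by the
  product of \<open>x * w'\<close> and \<open>x' * w\<close>, and the AM-GM inequality bounds that
  product by their sum. This controls the mixed term when convexity of the cone is checked.\<close>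

lemma rotated_cone_cross_le:
  fixes x w y x' w' y' :: real
  assumes "0 \<le> x" "0 \<le> w" "y\<^sup>2 \<le> x * w" and "0 \<le> x'" "0 \<le> w'" "y'\<^sup>2 \<le> x' * w'"
  shows "2 * y * y' \<le> x * w' + x' * w"
proof (rule power2_le_imp_le)
  have "(2 * y * y')\<^sup>2 = 4 * (y\<^sup>2 * y'\<^sup>2)"
    by (simp add: power_mult_distrib)
  also have "\<dots> \<le> 4 * ((x * w) * (x' * w'))"
    using assms by (intro mult_left_mono mult_mono) auto
  \<comment> \<open>The difference of the two sides is the square
    \<open>(x * w' - x' * w)\<^sup>2\<close>.\<close>
  also have "\<dots> \<le> (x * w' + x' * w)\<^sup>2"
    using zero_le_power2[of "x * w' - x' * w"] by (simp add: power2_eq_square algebra_simps)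
  finally show "(2 * y * y')\<^sup>2 \<le> (x * w' + x' * w)\<^sup>2" .
  show "0 \<le> x * w' + x' * w"
    using assms by simp
qed

lemma convex_rotated_cone:
  "convex {(x::real, w::real, y::real). 0 \<le> x \<and> 0 \<le> w \<and> y\<^sup>2 \<le> x * w}" (is "convex ?K")
proof (rule convexI)
  fix p q :: "real \<times> real \<times> real" and u v :: real
  assume "p \<in> ?K" "q \<in> ?K" and uv: "0 \<le> u" "0 \<le> v"
  then obtain x w y x' w' y' where p: "p = (x, w, y)" and q: "q = (x', w', y')"
    and cone: "0 \<le> x" "0 \<le> w" "y\<^sup>2 \<le> x * w" "0 \<le> x'" "0 \<le> w'" "y'\<^sup>2 \<le> x' * w'"
    by auto
  have "(u * y + v * y')\<^sup>2 = u\<^sup>2 * y\<^sup>2 + v\<^sup>2 * y'\<^sup>2 + u * v * (2 * y * y')"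
    by (simp add: power2_eq_square algebra_simps)
  also have "\<dots> \<le> u\<^sup>2 * (x * w) + v\<^sup>2 * (x' * w') + u * v * (x * w' + x' * w)"
    using cone uv rotated_cone_cross_le[OF cone] by (intro add_mono mult_left_mono) auto
  also have "\<dots> = (u * x + v * x') * (u * w + v * w')"
    by (simp add: power2_eq_square algebra_simps)
  finally show "u *\<^sub>R p + v *\<^sub>R q \<in> ?K"
    using cone uv by (simp add: p q)
qed

lemma h_opt_zero_zero: "h_opt (0, 0) = 0"
  by (simp add: h_opt_def zero_ereal_def)

lemma h_opt_pos: "0 < x \<Longrightarrow> h_opt (x, y) = ereal (y\<^sup>2 / x - 2 * y)"
  by (simp add: h_opt_def)

lemma h_opt_zero_nonzero: "y \<noteq> 0 \<Longrightarrow> h_opt (0, y) = \<infinity>"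
  by (simp add: h_opt_def ereal_pos_div_zero[unfolded zero_ereal_def[symmetric]])

text \<open>For \<open>x > 0\<close> this clears the denominator. At \<open>x = 0\<close> the
  quadratic condition forces \<open>y = 0\<close>, matching the value \<infinity> elsewhere, and the
  sign condition becomes \<open>0 \<le> s\<close>, matching \<open>0 / 0 = 0\<close>.\<close>

lemma h_opt_le_iff_rotated_cone:
  assumes "0 \<le> x"
  shows "h_opt (x, y) \<le> ereal s \<longleftrightarrow> 0 \<le> s + 2 * y \<and> y\<^sup>2 \<le> x * (s + 2 * y)"
proof (cases "x = 0")
  case True
  then show ?thesis
    by (cases "y = 0") (auto simp: h_opt_zero_zero h_opt_zero_nonzero)
next
  case False
  then have "0 < x" using assms by simp
  moreover have "0 \<le> s + 2 * y" if "y\<^sup>2 \<le> x * (s + 2 * y)"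
    using order_trans[OF zero_le_power2 that] \<open>0 < x\<close> by (simp add: zero_le_mult_iff)
  ultimately show ?thesis
    by (auto simp: h_opt_pos field_simps)
qed

lemma ext_convex_on_h_opt: "ext_convex_on ({0..1} \<times> {0..}) h_opt"
proof -
  let ?K = "{(x::real, w::real, y::real). 0 \<le> x \<and> 0 \<le> w \<and> y\<^sup>2 \<le> x * w}"
  \<comment> \<open>The cone coordinate \<open>w = s + 2 * y\<close> absorbs the linear term of
    \<open>h_opt\<close>.\<close>
  let ?L = "\<lambda>((x::real, y::real), s::real). (x, s + 2 * y, y)"
  have "linear ?L"
    by (rule linearI) (auto simp: algebra_simps)
  then have "convex (?L -` ?K)"
    using convex_rotated_cone by (rule convex_linear_vimage)
  moreover have "convex ((({0..1} :: real set) \<times> ({0..} :: real set)) \<times> (UNIV :: real set))"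
    by (intro convex_Times) auto
  moreover have "{(p, s). p \<in> {0..1} \<times> {0..} \<and> h_opt p \<le> ereal s} =
      (({0..1} \<times> {0..}) \<times> UNIV) \<inter> ?L -` ?K"
    by (auto simp: h_opt_le_iff_rotated_cone)
  ultimately show ?thesis
    unfolding ext_convex_on_def by (simp only: convex_Int)
qed

lemma valid_for_X_form_lhs_h_opt: "valid_for_X (form_lhs h_opt)"
  unfolding valid_for_X_def
proof (clarify)
  fix x y :: "real^2" and t :: real
  assume "(x, y, t) \<in> X"
  then have t: "(y $ 1 - y $ 2)\<^sup>2 \<le> t"
    and x: "x $ 1 = 0 \<or> x $ 1 = 1" "x $ 2 = 0 \<or> x $ 2 = 1"
    and y: "0 \<le> y $ 1" "y $ 1 \<le> x $ 1" "0 \<le> y $ 2" "y $ 2 \<le> x $ 2"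
    by (auto simp: X_def)
  \<comment> \<open>If \<open>x $ 1 = 0\<close>, then \<open>y $ 1 = 0\<close> and the quotient is
    \<open>0 / 0 = 0\<close>.\<close>
  have 1: "ereal ((y $ 1)\<^sup>2) / ereal (x $ 1) = ereal ((y $ 1)\<^sup>2)"
    using x(1) y by auto
  have 2: "h_opt (x $ 2, y $ 2) = ereal ((y $ 2)\<^sup>2 - 2 * y $ 2)"
    using x(2) y by (auto simp: h_opt_zero_zero h_opt_pos)
  \<comment> \<open>This is exactly what separates the product term of the expanded square from the
    linear term of \<open>h_opt\<close>; equality holds when \<open>y $ 1 = 1\<close>.\<close>
  have "y $ 1 * y $ 2 \<le> y $ 2"
    using x y by (intro mult_left_le_one_le) auto
  then have "(y $ 1)\<^sup>2 + ((y $ 2)\<^sup>2 - 2 * y $ 2) \<le> (y $ 1 - y $ 2)\<^sup>2"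
    by (simp add: power2_diff)
  with t show "form_lhs h_opt x y \<le> ereal t"
    by (simp only: form_lhs_def 1 2 plus_ereal.simps ereal_less_eq(3))
qed

text \<open>Test validity where \<open>x\<close> and \<open>y\<close> have first entry 1, with the
  least admissible \<open>t = (1 - y)\<^sup>2\<close>. The first quotient is then 1, leaving
  \<open>(1 - y)\<^sup>2 - 1\<close> as the bound.\<close>

lemma valid_for_X_imp_le:
  assumes "valid_for_X (form_lhs (\<lambda>p. ereal (h p)))"
    and "x \<in> {0, 1}" "0 \<le> y" "y \<le> x"
  shows "h (x, y) \<le> y\<^sup>2 - 2 * y"
proof -
  let ?x = "vector [1, x] :: real^2" and ?y = "vector [1, y] :: real^2"
  have "(?x, ?y, (1 - y)\<^sup>2) \<in> X"
    using assms(2-4) by (auto simp: X_def forall_2 vector_2)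
  then have "form_lhs (\<lambda>p. ereal (h p)) ?x ?y \<le> ereal ((1 - y)\<^sup>2)"
    using assms(1) unfolding valid_for_X_def by blast
  then show ?thesis
    by (simp add: form_lhs_def vector_2 power2_diff one_ereal_def)
qed

lemma valid_convex_le_h_opt:
  assumes convex: "convex_on ({0..1} \<times> {0..}) h"
    and valid: "valid_for_X (form_lhs (\<lambda>p. ereal (h p)))"
    and xy: "0 \<le> y" "y \<le> x" "x \<le> 1"
  shows "ereal (h (x, y)) \<le> h_opt (x, y)"
proof (cases "x = 0")
  case True
  then show ?thesis
    using xy valid_for_X_imp_le[OF valid, of 0 0] by (simp add: h_opt_zero_zero)
next
  case False
  with xy have "0 < x" by simp
  have "h (x, y) = h ((1 - x) *\<^sub>R (0, 0) + x *\<^sub>R (1, y / x))"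
    using \<open>0 < x\<close> by simp
  also have "\<dots> \<le> (1 - x) * h (0, 0) + x * h (1, y / x)"
    using xy \<open>0 < x\<close> by (intro convex_onD[OF convex]) auto
  \<comment> \<open>Since \<open>y \<le> x\<close>, the slope \<open>y / x\<close> lies in [0,1], so
    the bound from validity applies at both endpoints of the segment.\<close>
  also have "\<dots> \<le> (1 - x) * 0 + x * ((y / x)\<^sup>2 - 2 * (y / x))"
    using xy \<open>0 < x\<close> valid_for_X_imp_le[OF valid, of 0 0]
      valid_for_X_imp_le[OF valid, of 1 "y / x"]
    by (intro add_mono mult_left_mono) auto
  also have "\<dots> = y\<^sup>2 / x - 2 * y"
    using \<open>0 < x\<close> by (simp add: power2_eq_square field_simps)
  finally show ?thesis
    using \<open>0 < x\<close> by (simp add: h_opt_pos)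
qed

theorem proposition7:
  shows "valid_for_X (form_lhs h_opt) \<and>
         ext_convex_on ({0..1} \<times> {0..}) h_opt \<and>
         (\<forall>h :: real \<times> real \<Rightarrow> real.
           convex_on ({0..1} \<times> {0..}) h \<longrightarrow>
           valid_for_X (form_lhs (\<lambda>p. ereal (h p))) \<longrightarrow>
           (\<forall>x2 y2. 0 \<le> y2 \<and> y2 \<le> x2 \<and> x2 \<le> 1 \<longrightarrow> ereal (h (x2, y2)) \<le> h_opt (x2, y2)))"
  using valid_for_X_form_lhs_h_opt ext_convex_on_h_opt valid_convex_le_h_opt by blast

end
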